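(* Let $\delta>0$ and let $\boldsymbol{\bar P}_j=(\bar P_j^{(1)},\dots,\bar P_j^{(N)})^{\mathrm T}$ be the limited reconstruction polynomials on the cell $I_j$ obtained from the component-wise WENO reconstruction polynomials $P_j^{(1)},\dots,P_j^{(N)}$ by the two-step limiter described in the context. If $\Phi_j^n\in\mathcal D^\delta_{\phi_{\max}}$, then $\boldsymbol{\bar P}_j(x)\in\mathcal D_{\phi_{\max}}$ for all $x\in I_j$. In particular, this is true for all $x\in S_j$, where $S_j\subset I_j$ is the set of nodes of the $G$-point Legendre--Gauss--Lobatto quadrature rule on $I_j$.
   Context: Sets. $N\ge1$, $\phi_{\max}>0$, and $$\mathcal D_{\phi_{\max}}=\{\Phi\in\mathbb R^N:\phi_1\ge0,\dots,\phi_N\ge0,\ \phi_1+\dots+\phi_N\le\phi_{\max}\},$$ $$\mathcal D^\delta_{\phi_{\max}}=\{\Phi\in\mathbb R^N:\phi_1\ge\delta,\dots,\phi_N\ge\delta,\ \phi_1+\dots+\phi_N\le\phi_{\max}\}.$$ Grid. Cells $I_j=[x_{j-1/2},x_{j+1/2}]$ of uniform width $\Delta x$; $\Phi_j^n=(\phi_{1,j}^n,\dots,\phi_{N,j}^n)^{\mathrm T}$ is the vector of cell averages in cell $j$ at time level $n$, and $\phi_j^n:=\phi_{1,j}^n+\dots+\phi_{N,j}^n$. WENO reconstruction (applied to each component $i$ separately, with $\bar u_l:=\phi_{i,l}^n$). Fix $r\in\{1,2\}$. Let $P_{\mathrm{opt}}$ be the polynomial of degree $\le2r$ whose averages over $I_{j+\ell}$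 are $\bar u_{j+\ell}$ for $\ell=-r,\dots,r$, and, for $k=1,\dots,r+1$, let $P_k$ be the polynomial of degree $\le r$ whose averages over $I_{j-r+k+\ell-1}$ are $\bar u_{j-r+k+\ell-1}$ for $\ell=0,\dots,r$. With linear weights $C_0,\dots,C_{r+1}\in[0,1]$, $\sum_kC_k=1$, $C_0>0$, put $P_0=\frac1{C_0}\bigl(P_{\mathrm{opt}}-\sum_{k=1}^{r+1}C_kP_k\bigr)$, $\alpha_k=C_k/(IS_k+\varepsilon)^p$ and $\omega_k=\alpha_k/(\alpha_0+\dots+\alpha_{r+1})$ for $k=0,\dots,r+1$, where $\varepsilon>0$, $p\ge2$ and $IS_k=\sum_{\ell=1}^{\deg P_k}\Delta x^{2\ell-1}\int_{I_j}(P_k^{(\ell)}(x))^2\,\mathrm dx$ (here $P_k^{(\ell)}$ is the $\ell$-th derivative). The reconstruction polynomial is $P_j^{(i)}=\sum_{k=0}^{r+1}\omega_kP_k$; it has average $\phi_{i,j}^n$ over $I_j$. Limiter. Step 1: for $i=1,\dots,N$, $$\tilde P_j^{(i)}(x)=\theta_i\bigl(P_j^{(i)}(x)-\phi_{i,j}^n\bigr)+\phi_{i,j}^n,\quad \theta_i=\min\Bigl\{\frac{\phi_{i,j}^n-\delta}{\phi_{i,j}^n-m_j^{(i)}},1\Bigr\},\quad m_j^{(i)}=\min_{x\in I_j}P_j^{(i)}(x).$$ Step 2: $$\bar P_j^{(i)}(x)=\hat\theta\bigl(\tilde P_j^{(i)}(x)-\phi_{i,j}^n\bigr)+\phi_{i,j}^n,\quad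 \hat\theta=\min\Bigl\{\Bigl|\frac{\phi_{\max}-\phi_j^n}{M_j-\phi_j^n}\Bigr|,1\Bigr\},\quad M_j=\max_{x\in I_j}\sum_{i=1}^N\tilde P_j^{(i)}(x).$$ When a denominator vanishes, the corresponding $\theta_i$ or $\hat\theta$ is taken to be $1$. *)

theory Defs
  imports "HOL-Analysis.Analysis" "HOL-Computational_Algebra.Polynomial"
begin

definition phi_domain :: "real \<Rightarrow> (real ^ 'N) set" where
  "phi_domain \<phi>max = {\<Phi>. (\<forall>i. \<Phi> $ i \<ge> 0) \<and> (\<Sum>i\<in>UNIV. \<Phi> $ i) \<le> \<phi>max}"

definition phi_domain_delta :: "real \<Rightarrow> real \<Rightarrow> (real ^ 'N) set" where
  "phi_domain_delta \<delta> \<phi>max = {\<Phi>. (\<forall>i. \<Phi> $ i \<ge> \<delta>) \<and> (\<Sum>i\<in>UNIV. \<Phi> $ i) \<le> \<phi>max}"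

text \<open>
  The grid is uniform with cell width \<open>h\<close>; \<open>a\<close> is the centre of cell \<open>0\<close>,
  so that the cell interfaces are \<open>x\<^sub>s = a + s h\<close> for half-integers \<open>s\<close>.
\<close>

definition cell :: "real \<Rightarrow> real \<Rightarrow> int \<Rightarrow> real set" where
  "cell a h j = {a + (of_int j - 1/2) * h .. a + (of_int j + 1/2) * h}"

definition cell_average :: "real \<Rightarrow> real \<Rightarrow> int \<Rightarrow> real poly \<Rightarrow> real" where
  "cell_average a h j P = (1 / h) * integral (cell a h j) (poly P)"

text \<open>
  The polynomial of degree at most \<open>d\<close> whose averages over the \<open>d + 1\<close> consecutive
  cells \<open>s, \<dots>, s + d\<close> are prescribed by \<open>u\<close>; lemma \<open>average_interpolant_unique_existence\<close>
  below justifies the definite description.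
\<close>

definition average_interpolant ::
    "real \<Rightarrow> real \<Rightarrow> (int \<Rightarrow> real) \<Rightarrow> nat \<Rightarrow> int \<Rightarrow> real poly" where
  "average_interpolant a h u d s =
     (THE P. degree P \<le> d \<and> (\<forall>l\<le>d. cell_average a h (s + int l) P = u (s + int l)))"

definition P_opt :: "real \<Rightarrow> real \<Rightarrow> nat \<Rightarrow> (int \<Rightarrow> real) \<Rightarrow> int \<Rightarrow> real poly" where
  "P_opt a h r u j = average_interpolant a h u (2 * r) (j - int r)"

definition P_low :: "real \<Rightarrow> real \<Rightarrow> nat \<Rightarrow> (int \<Rightarrow> real) \<Rightarrow> int \<Rightarrow> nat \<Rightarrow> real poly" where
  "P_low a h r u j k = average_interpolant a h u r (j - int r + int k - 1)"

definition P_cand ::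
    "real \<Rightarrow> real \<Rightarrow> nat \<Rightarrow> (nat \<Rightarrow> real) \<Rightarrow> (int \<Rightarrow> real) \<Rightarrow> int \<Rightarrow> nat \<Rightarrow> real poly" where
  "P_cand a h r C u j k =
     (if k = 0
      then smult (1 / C 0) (P_opt a h r u j - (\<Sum>k=1..r+1. smult (C k) (P_low a h r u j k)))
      else P_low a h r u j k)"

definition smoothness_indicator :: "real \<Rightarrow> real \<Rightarrow> int \<Rightarrow> real poly \<Rightarrow> real" where
  "smoothness_indicator a h j P =
     (\<Sum>l=1..degree P. h ^ (2 * l - 1) *
        integral (cell a h j) (\<lambda>x. (poly ((pderiv ^^ l) P) x)\<^sup>2))"

definition weno_alpha ::
    "real \<Rightarrow> real \<Rightarrow> nat \<Rightarrow> (nat \<Rightarrow> real) \<Rightarrow> real \<Rightarrow> real \<Rightarrow> (int \<Rightarrow> real) \<Rightarrow> int \<Rightarrow> nat \<Rightarrow> real" where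
  "weno_alpha a h r C \<epsilon> p u j k =
     C k / (smoothness_indicator a h j (P_cand a h r C u j k) + \<epsilon>) powr p"

definition weno_omega ::
    "real \<Rightarrow> real \<Rightarrow> nat \<Rightarrow> (nat \<Rightarrow> real) \<Rightarrow> real \<Rightarrow> real \<Rightarrow> (int \<Rightarrow> real) \<Rightarrow> int \<Rightarrow> nat \<Rightarrow> real" where
  "weno_omega a h r C \<epsilon> p u j k =
     weno_alpha a h r C \<epsilon> p u j k / (\<Sum>m=0..r+1. weno_alpha a h r C \<epsilon> p u j m)"

definition weno_poly ::
    "real \<Rightarrow> real \<Rightarrow> nat \<Rightarrow> (nat \<Rightarrow> real) \<Rightarrow> real \<Rightarrow> real \<Rightarrow> (int \<Rightarrow> real) \<Rightarrow> int \<Rightarrow> real poly" where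
  "weno_poly a h r C \<epsilon> p u j =
     (\<Sum>k=0..r+1. smult (weno_omega a h r C \<epsilon> p u j k) (P_cand a h r C u j k))"

text \<open>
  The limiter acts on a cell \<open>I\<close>, a vector \<open>\<Phi>\<close> of cell averages and a family \<open>P\<close> of
  polynomials indexed by the components. The extrema over \<open>I\<close> are attained whenever \<open>I\<close>
  is compact and nonempty.
\<close>

definition limiter_theta ::
    "real \<Rightarrow> real set \<Rightarrow> real ^ 'N \<Rightarrow> ('N \<Rightarrow> real poly) \<Rightarrow> 'N \<Rightarrow> real" where
  "limiter_theta \<delta> I \<Phi> P i =
     (let m = (LEAST y. y \<in> poly (P i) ` I)
      in if \<Phi> $ i - m = 0 then 1 else min ((\<Phi> $ i - \<delta>) / (\<Phi> $ i - m)) 1)"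

definition limiter_step1 ::
    "real \<Rightarrow> real set \<Rightarrow> real ^ 'N \<Rightarrow> ('N \<Rightarrow> real poly) \<Rightarrow> 'N \<Rightarrow> real poly" where
  "limiter_step1 \<delta> I \<Phi> P i =
     smult (limiter_theta \<delta> I \<Phi> P i) (P i - [:\<Phi> $ i:]) + [:\<Phi> $ i:]"

definition limiter_theta_hat ::
    "real \<Rightarrow> real set \<Rightarrow> real ^ 'N \<Rightarrow> ('N \<Rightarrow> real poly) \<Rightarrow> real" where
  "limiter_theta_hat \<phi>max I \<Phi> P =
     (let M = (GREATEST y. y \<in> (\<lambda>x. \<Sum>i\<in>UNIV. poly (P i) x) ` I);
          \<phi> = (\<Sum>i\<in>UNIV. \<Phi> $ i)
      in if M - \<phi> = 0 then 1 else min \<bar>(\<phi>max - \<phi>) / (M - \<phi>)\<bar> 1)"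

definition limiter_step2 ::
    "real \<Rightarrow> real set \<Rightarrow> real ^ 'N \<Rightarrow> ('N \<Rightarrow> real poly) \<Rightarrow> 'N \<Rightarrow> real poly" where
  "limiter_step2 \<phi>max I \<Phi> P i =
     smult (limiter_theta_hat \<phi>max I \<Phi> P) (P i - [:\<Phi> $ i:]) + [:\<Phi> $ i:]"

definition limited_poly ::
    "real \<Rightarrow> real \<Rightarrow> real set \<Rightarrow> real ^ 'N \<Rightarrow> ('N \<Rightarrow> real poly) \<Rightarrow> 'N \<Rightarrow> real poly" where
  "limited_poly \<delta> \<phi>max I \<Phi> P = limiter_step2 \<phi>max I \<Phi> (limiter_step1 \<delta> I \<Phi> P)"

definition limited_reconstruction ::
    "real \<Rightarrow> real \<Rightarrow> nat \<Rightarrow> (nat \<Rightarrow> real) \<Rightarrow> real \<Rightarrow> real \<Rightarrow> real \<Rightarrow> real \<Rightarrow>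
     (int \<Rightarrow> real ^ 'N) \<Rightarrow> int \<Rightarrow> real \<Rightarrow> real ^ 'N" where
  "limited_reconstruction a h r C \<epsilon> p \<delta> \<phi>max \<Phi> j x =
     (\<chi> i. poly (limited_poly \<delta> \<phi>max (cell a h j) (\<Phi> j)
                  (\<lambda>i. weno_poly a h r C \<epsilon> p (\<lambda>l. \<Phi> l $ i) j) i) x)"

text \<open>The Legendre polynomials, by Rodrigues' formula.\<close>

definition legendre_poly :: "nat \<Rightarrow> real poly" where
  "legendre_poly n = smult (1 / (2 ^ n * fact n)) ((pderiv ^^ n) ([:-1, 0, 1:] ^ n))"

text \<open>
  The \<open>G\<close>-point Legendre--Gauss--Lobatto nodes (\<open>G \<ge> 2\<close>) on \<open>[-1,1]\<close> are the zeros of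
  \<open>(1 - \<xi>\<^sup>2) L'(\<xi>)\<close>, where \<open>L\<close> is the Legendre polynomial of degree \<open>G - 1\<close>; on a cell they
  are the images of these under the affine map from \<open>[-1,1]\<close>.
\<close>

definition lgl_reference_nodes :: "nat \<Rightarrow> real set" where
  "lgl_reference_nodes G = {\<xi>. poly ([:1, 0, -1:] * pderiv (legendre_poly (G - 1))) \<xi> = 0}"

definition lgl_nodes :: "real \<Rightarrow> real \<Rightarrow> nat \<Rightarrow> int \<Rightarrow> real set" where
  "lgl_nodes a h G j = (\<lambda>\<xi>. a + of_int j * h + h / 2 * \<xi>) ` lgl_reference_nodes G"

lemma cell_average_pderiv:
  assumes "h > 0"
  shows "cell_average a h j (pderiv Q) =
    (poly Q (a + (of_int j + 1/2) * h) - poly Q (a + (of_int j - 1/2) * h)) / h"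
proof -
  have "(poly (pderiv Q) has_integral
      poly Q (a + (of_int j + 1/2) * h) - poly Q (a + (of_int j - 1/2) * h)) (cell a h j)"
    unfolding cell_def
  proof (rule fundamental_theorem_of_calculus)
    show "a + (of_int j - 1/2) * h \<le> a + (of_int j + 1/2) * h"
      using assms by (simp add: algebra_simps)
  next
    fix x
    show "(poly Q has_vector_derivative poly (pderiv Q) x)
        (at x within {a + (of_int j - 1/2) * h..a + (of_int j + 1/2) * h})"
      by (rule has_vector_derivative_at_within)
        (simp add: poly_DERIV flip: has_real_derivative_iff_has_vector_derivative)
  qed
  thus ?thesis by (simp add: cell_average_def integral_unique)
qed

lemma poly_integrable_on_cell: "poly P integrable_on cell a h j"
  unfolding cell_def by (intro integrable_continuous_interval continuous_intros)

lemma cell_average_add: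
  "cell_average a h j (P + Q) = cell_average a h j P + cell_average a h j Q"
proof -
  have "poly (P + Q) = (\<lambda>x. poly P x + poly Q x)" by auto
  thus ?thesis
    by (simp add: cell_average_def Henstock_Kurzweil_Integration.integral_add
        poly_integrable_on_cell distrib_left add_divide_distrib)
qed

lemma cell_average_smult: "cell_average a h j (smult c P) = c * cell_average a h j P"
proof -
  have "poly (smult c P) = (\<lambda>x. c * poly P x)" by auto
  thus ?thesis by (simp add: cell_average_def)
qed

lemma average_interpolant_exists:
  assumes "h > 0"
  shows "\<exists>P. degree P \<le> d \<and> (\<forall>l\<le>d. cell_average a h (s + int l) P = u (s + int l))"
proof (induction d)
  case 0
  have "cell_average a h s [:u s:] = u s"
    using assms cell_average_pderiv[of h a s "[:0, u s:]"] by (simp add: pderiv_pCons field_simps)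
  thus ?case by (intro exI[of _ "[:u s:]"]) simp
next
  case (Suc d)
  then obtain P where P: "degree P \<le> d"
    "\<And>l. l \<le> d \<Longrightarrow> cell_average a h (s + int l) P = u (s + int l)" by blast
  define f where "f m = a + (of_int s + of_nat m - 1/2) * h" for m :: nat
  define W where "W = (\<Prod>m\<le>Suc d. [:- f m, 1:])"
  have W: "poly W x = (\<Prod>m\<le>Suc d. x - f m)" for x
    by (simp only: W_def poly_prod) simp
  have dW: "degree W = Suc (Suc d)"
    unfolding W_def by (subst degree_prod_sum_eq) auto
  have avg: "cell_average a h (s + int l) (pderiv W) = (poly W (f (Suc l)) - poly W (f l)) / h" for l
    using cell_average_pderiv[OF assms, of a "s + int l" W] by (simp add: f_def algebra_simps)
  have zero: "poly W (f m) = 0" if "m \<le> Suc d" for m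
    unfolding W using that by (intro prod_zero) auto
  have inj: "f m \<noteq> f m'" if "m \<noteq> m'" for m m' using that assms by (simp add: f_def)
  have nz: "poly W (f (Suc (Suc d))) \<noteq> 0"
  proof -
    have "f (Suc (Suc d)) - f m \<noteq> 0" if "m \<le> Suc d" for m
      using inj[of "Suc (Suc d)" m] that by simp
    thus ?thesis unfolding W prod_zero_iff[OF finite_atMost] by blast
  qed
  define A where "A = cell_average a h (s + int (Suc d)) (pderiv W)"
  have A: "A \<noteq> 0" using nz zero assms by (simp add: A_def avg del: of_nat_Suc)
  define c where "c = (u (s + int (Suc d)) - cell_average a h (s + int (Suc d)) P) / A"
  define Q where "Q = P + smult c (pderiv W)"
  have "degree (smult c (pderiv W)) \<le> Suc d"
    using degree_smult_le[of c "pderiv W"] by (simp add: degree_pderiv dW)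
  hence "degree Q \<le> Suc d"
    unfolding Q_def using P(1) by (intro degree_add_le) auto
  moreover have "cell_average a h (s + int l) Q = u (s + int l)" if "l \<le> Suc d" for l
  proof (cases "l = Suc d")
    case True
    thus ?thesis using A by (simp add: Q_def cell_average_add cell_average_smult c_def A_def)
  next
    case False
    hence "l \<le> d" using that by simp
    thus ?thesis using P(2) zero by (simp add: Q_def cell_average_add cell_average_smult avg)
  qed
  ultimately show ?case by blast
qed

lemma zero_average_imp_root:
  assumes "h > 0" "cell_average a h j P = 0"
  shows "\<exists>x. a + (of_int j - 1/2) * h < x \<and> x < a + (of_int j + 1/2) * h \<and> poly P x = 0"
proof -
  obtain Q where Q: "pderiv Q = P"
  proof
    let ?Q = "\<Sum>i\<le>degree P. monom (coeff P i / real (Suc i)) (Suc i)"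
    have "pderiv ?Q = (\<Sum>i\<le>degree P. monom (coeff P i) i)"
      by (simp add: higher_pderiv_sum[of 1, simplified] pderiv_monom del: of_nat_Suc)
    thus "pderiv ?Q = P" by (simp add: poly_as_sum_of_monoms)
  qed
  let ?l = "a + (of_int j - 1/2) * h" and ?r = "a + (of_int j + 1/2) * h"
  have "?l < ?r" using assms by (simp add: algebra_simps)
  moreover have "poly Q ?r = poly Q ?l"
    using assms cell_average_pderiv[of h a j Q] Q by simp
  moreover obtain x where "?l < x" "x < ?r"
    "poly Q ?r - poly Q ?l = (?r - ?l) * poly (pderiv Q) x"
    using poly_MVT[OF \<open>?l < ?r\<close>, of Q] by blast
  ultimately show ?thesis
    using Q assms(1) by (intro exI[of _ x]) auto
qed

lemma average_interpolant_unique_existence: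
  assumes "h > 0"
  shows "\<exists>!P. degree P \<le> d \<and> (\<forall>l\<le>d. cell_average a h (s + int l) P = u (s + int l))"
proof (rule ex_ex1I[OF average_interpolant_exists[OF assms]])
  fix P Q
  assume P: "degree P \<le> d \<and> (\<forall>l\<le>d. cell_average a h (s + int l) P = u (s + int l))"
  assume Q: "degree Q \<le> d \<and> (\<forall>l\<le>d. cell_average a h (s + int l) Q = u (s + int l))"
  define R where "R = P + smult (-1) Q"
  have "degree (smult (-1) Q) \<le> d" using Q by simp
  hence deg: "degree R \<le> d" unfolding R_def using P by (intro degree_add_le) auto
  have avg: "cell_average a h (s + int l) R = 0" if "l \<le> d" for l
    unfolding R_def cell_average_add cell_average_smult using P Q that by simp
  define B where "B l y \<longleftrightarrow> a + (of_int (s + int l) - 1/2) * h < y \<and>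
      y < a + (of_int (s + int l) + 1/2) * h \<and> poly R y = 0" for l y
  define x where "x l = (SOME y. B l y)" for l
  have "B l (x l)" if "l \<le> d" for l
    unfolding x_def
  proof (rule someI_ex)
    show "\<exists>y. B l y"
      unfolding B_def by (rule zero_average_imp_root[OF assms avg[OF that]])
  qed
  note x = this[unfolded B_def]
  have lt: "x l < x m" if "l < m" "m \<le> d" for l m
  proof -
    have "x l < a + (of_int (s + int l) + 1/2) * h" using x[of l] that by linarith
    also have "\<dots> \<le> a + (of_int (s + int m) - 1/2) * h"
      using that assms by (intro add_left_mono mult_right_mono) linarith+
    also have "\<dots> < x m" using x[of m] that by linarith
    finally show ?thesis .
  qed
  have inj: "inj_on x {..d}"
    by (intro strict_mono_on_imp_inj_on strict_mono_onI) (simp add: lt)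
  have "R = 0"
  proof (rule ccontr)
    assume nz: "R \<noteq> 0"
    have "x ` {..d} \<subseteq> {z. poly R z = 0}" using x by blast
    hence "card (x ` {..d}) \<le> card {z. poly R z = 0}"
      by (intro card_mono poly_roots_finite nz)
    also have "\<dots> \<le> degree R" using nz by (rule card_poly_roots_bound)
    finally show False using deg by (simp add: card_image[OF inj])
  qed
  thus "P = Q" by (simp add: R_def)
qed

end

theory Submission
  imports Defs
begin

text \<open>
  A limited polynomial has the same cell average as the reconstruction, and by the mean value
  theorem a polynomial attains its average over the cell. Hence \<open>m \<le> \<phi>\<^sub>i\<close> and \<open>\<phi> \<le> M\<close>, so both
  limiter parameters lie in \<open>[0,1]\<close> and each step pulls the polynomial towards its average just
  far enough to enforce the bound; the second step is a convex combination of two functions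
  that are at least \<open>\<delta>\<close>.

  The Lobatto nodes lie in \<open>[-1,1]\<close> because \<open>(x\<^sup>2 - 1)\<^sup>n\<close> becomes \<open>t\<^sup>n (t + 2)\<^sup>n\<close> under both
  \<open>x = 1 + t\<close> and \<open>x = -1 - t\<close>; this polynomial has nonnegative coefficients, so none of its
  derivatives up to order \<open>2n\<close> vanishes for \<open>t > 0\<close>.
\<close>

section \<open>Averages of the reconstruction\<close>

lemma cell_average_const: "h > 0 \<Longrightarrow> cell_average a h j [:c:] = c"
  using cell_average_pderiv[of h a j "[:0, c:]"] by (simp add: pderiv_pCons field_simps)

lemma cell_average_diff:
  "cell_average a h j (P - Q) = cell_average a h j P - cell_average a h j Q"
  using cell_average_add[of a h j P "smult (-1) Q"] cell_average_smult[of a h j "-1" Q] by simp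

lemma cell_average_sum:
  "cell_average a h j (\<Sum>k\<in>A. f k) = (\<Sum>k\<in>A. cell_average a h j (f k))"
proof (induction A rule: infinite_finite_induct)
  case empty
  \<comment> \<open>The instance with scalar 0 shows that the zero polynomial has average 0; the
    infinite case falls back on the same fact.\<close>
  show ?case using cell_average_smult[of a h j 0 0] by simp
next
  case (infinite A)
  thus ?case using cell_average_smult[of a h j 0 0] by simp
qed (simp_all add: cell_average_add)

text \<open>Subtracting the average leaves a polynomial of average 0, which has a root inside the
  cell.\<close>

lemma cell_average_attained:
  assumes "h > 0"
  obtains x where "x \<in> cell a h j" "poly P x = cell_average a h j P"
proof -
  have "cell_average a h j (P - [:cell_average a h j P:]) = 0"
    by (simp add: cell_average_diff cell_average_const assms)
  from zero_average_imp_root[OF assms this] obtain x where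
    "a + (of_int j - 1/2) * h < x" "x < a + (of_int j + 1/2) * h"
    "poly (P - [:cell_average a h j P:]) x = 0" by blast
  thus ?thesis by (intro that[of x]) (auto simp: cell_def)
qed

lemma cell_average_average_interpolant:
  assumes "h > 0" "l \<le> d"
  shows "cell_average a h (s + int l) (average_interpolant a h u d s) = u (s + int l)"
  using theI'[OF average_interpolant_unique_existence[OF assms(1), of d a s u]] assms(2)
  unfolding average_interpolant_def by blast

lemma cell_average_P_opt: "h > 0 \<Longrightarrow> cell_average a h j (P_opt a h r u j) = u j"
  using cell_average_average_interpolant[of h r "2 * r" a "j - int r" u] by (simp add: P_opt_def)

lemma cell_average_P_low:
  assumes "h > 0" "k \<in> {1..r+1}"
  shows "cell_average a h j (P_low a h r u j k) = u j"
proof -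
  \<comment> \<open>Cell \<open>j\<close> is entry \<open>r + 1 - k\<close> of the stencil:
    \<open>k \<le> r + 1\<close> prevents truncated subtraction, and \<open>k \<ge> 1\<close> keeps
    the index at most \<open>r\<close>.\<close>
  have "j - int r + int k - 1 + int (r + 1 - k) = j" using assms(2) by auto
  thus ?thesis
    using cell_average_average_interpolant[of h "r + 1 - k" r a "j - int r + int k - 1" u] assms
    by (simp add: P_low_def)
qed

text \<open>For \<open>k = 0\<close> the low-order polynomials carry total weight
  \<open>1 - C 0\<close>, so the difference has average \<open>C 0 * u j\<close>, and dividing by
  \<open>C 0\<close> restores \<open>u j\<close>.\<close>

lemma cell_average_P_cand:
  assumes "h > 0" "(\<Sum>k=0..r+1. C k) = 1" "C 0 > 0" "k \<le> r + 1"
  shows "cell_average a h j (P_cand a h r C u j k) = u j"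
proof (cases "k = 0")
  case True
  have "(\<Sum>k=1..r+1. C k * cell_average a h j (P_low a h r u j k)) = (\<Sum>k=1..r+1. C k) * u j"
    unfolding sum_distrib_right
    by (intro sum.cong refl) (simp add: cell_average_P_low assms(1))
  also have "(\<Sum>k=1..r+1. C k) = 1 - C 0"
    using assms(2) by (simp add: sum.atLeast_Suc_atMost)
  finally have "cell_average a h j (P_cand a h r C u j 0) = 1 / C 0 * (u j - (1 - C 0) * u j)"
    using assms(1) by (simp add: P_cand_def cell_average_smult cell_average_diff
        cell_average_sum cell_average_P_opt del: sum.cl_ivl_Suc)
  also have "\<dots> = u j" using assms(3) by (simp add: field_simps)
  finally show ?thesis using True by simp
next
  case False
  thus ?thesis using assms by (simp add: P_cand_def cell_average_P_low)
qed

lemma smoothness_indicator_nonneg: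
  assumes "h > 0"
  shows "smoothness_indicator a h j P \<ge> 0"
  unfolding smoothness_indicator_def cell_def
  using assms
  by (intro sum_nonneg mult_nonneg_nonneg integral_nonneg integrable_continuous_interval
      continuous_intros) auto

text \<open>Normalisation needs a nonzero denominator: the term of index 0 is positive and the
  others are nonnegative.\<close>

lemma sum_weno_omega:
  assumes "h > 0" "\<forall>k\<in>{0..r+1}. C k \<ge> 0" "C 0 > 0" "\<epsilon> > 0"
  shows "(\<Sum>k=0..r+1. weno_omega a h r C \<epsilon> p u j k) = 1"
proof -
  let ?\<alpha> = "weno_alpha a h r C \<epsilon> p u j"
  have "smoothness_indicator a h j (P_cand a h r C u j 0) + \<epsilon> > 0"
    using smoothness_indicator_nonneg[OF assms(1)] assms(4) by (rule add_nonneg_pos)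
  hence "?\<alpha> 0 > 0" using assms(3) by (simp add: weno_alpha_def)
  moreover have "?\<alpha> k \<ge> 0" if "k \<in> {0..r+1}" for k
    using that assms(2) by (simp add: weno_alpha_def)
  ultimately have "(\<Sum>k=0..r+1. ?\<alpha> k) > 0"
    by (intro sum_pos2[of _ 0]) auto
  thus ?thesis unfolding weno_omega_def sum_divide_distrib[symmetric] by simp
qed

text \<open>All candidates share the average \<open>u j\<close>, so any weights summing to 1
  preserve it.\<close>

lemma cell_average_weno_poly:
  assumes "h > 0" "\<forall>k\<in>{0..r+1}. C k \<ge> 0" "(\<Sum>k=0..r+1. C k) = 1" "C 0 > 0" "\<epsilon> > 0"
  shows "cell_average a h j (weno_poly a h r C \<epsilon> p u j) = u j"
proof -
  have "cell_average a h j (weno_poly a h r C \<epsilon> p u j) =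
      (\<Sum>k=0..r+1. weno_omega a h r C \<epsilon> p u j k * u j)"
    unfolding weno_poly_def cell_average_sum cell_average_smult
    by (intro sum.cong refl) (simp add: cell_average_P_cand[OF assms(1,3,4)])
  also have "\<dots> = u j"
    using sum_weno_omega[OF assms(1,2,4,5)] by (simp only: mult_1_left flip: sum_distrib_right)
  finally show ?thesis .
qed

section \<open>The limiter\<close>

text \<open>\<open>LEAST\<close> is informative only for an attained minimum; compactness and
  continuity supply the minimiser.\<close>

lemma Least_image_le:
  fixes f :: "'a :: topological_space \<Rightarrow> 'b :: linorder_topology"
  assumes "compact I" "continuous_on I f" "x \<in> I"
  shows "(LEAST y. y \<in> f ` I) \<le> f x"
proof -
  obtain z where "z \<in> I" "\<And>y. y \<in> I \<Longrightarrow> f z \<le> f y"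
    using continuous_attains_inf[OF assms(1) _ assms(2)] assms(3) by blast
  hence "(LEAST y. y \<in> f ` I) = f z" by (intro Least_equality) auto
  thus ?thesis using \<open>\<And>y. y \<in> I \<Longrightarrow> f z \<le> f y\<close> assms(3) by simp
qed

lemma Greatest_image_ge:
  fixes f :: "'a :: topological_space \<Rightarrow> 'b :: linorder_topology"
  assumes "compact I" "continuous_on I f" "x \<in> I"
  shows "f x \<le> (GREATEST y. y \<in> f ` I)"
proof -
  obtain z where "z \<in> I" "\<And>y. y \<in> I \<Longrightarrow> f y \<le> f z"
    using continuous_attains_sup[OF assms(1) _ assms(2)] assms(3) by blast
  hence "(GREATEST y. y \<in> f ` I) = f z" by (intro Greatest_equality) auto
  thus ?thesis using \<open>\<And>y. y \<in> I \<Longrightarrow> f y \<le> f z\<close> assms(3) by simp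
qed

text \<open>The point \<open>x0\<close> forces \<open>m \<le> \<Phi> $ i\<close>. The largest drop
  below the average, \<open>\<Phi> $ i - m\<close>, is then scaled by \<open>\<theta>\<close> to at
  most \<open>\<Phi> $ i - \<delta>\<close>.\<close>

lemma poly_limiter_step1_ge:
  assumes "compact I" "x \<in> I" "x0 \<in> I" "poly (P i) x0 = \<Phi> $ i" "\<Phi> $ i \<ge> \<delta>"
  shows "poly (limiter_step1 \<delta> I \<Phi> P i) x \<ge> \<delta>"
proof -
  define m where "m = (LEAST y. y \<in> poly (P i) ` I)"
  define \<theta> where "\<theta> = limiter_theta \<delta> I \<Phi> P i"
  have m: "m \<le> poly (P i) y" if "y \<in> I" for y
    unfolding m_def using assms(1) that by (intro Least_image_le continuous_intros)
  have "m \<le> \<Phi> $ i" using m[OF assms(3)] assms(4) by simp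
  have \<theta>: "\<theta> = (if \<Phi> $ i - m = 0 then 1 else min ((\<Phi> $ i - \<delta>) / (\<Phi> $ i - m)) 1)"
    by (simp add: \<theta>_def m_def limiter_theta_def)
  have "\<theta> \<ge> 0" using \<theta> \<open>m \<le> \<Phi> $ i\<close> assms(5) by auto
  have "\<theta> * (\<Phi> $ i - m) \<le> \<Phi> $ i - \<delta>"
  proof (cases "\<Phi> $ i = m")
    case False
    hence "\<Phi> $ i - m > 0" using \<open>m \<le> \<Phi> $ i\<close> by simp
    moreover have "\<theta> \<le> (\<Phi> $ i - \<delta>) / (\<Phi> $ i - m)" using \<theta> False by simp
    ultimately show ?thesis by (simp add: pos_le_divide_eq)
  \<comment> \<open>With a vanishing denominator the left side is 0, and the claim reduces to
    \<open>\<delta> \<le> \<Phi> $ i\<close>.\<close>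
  qed (use assms(5) in simp)
  moreover have "\<theta> * (m - \<Phi> $ i) \<le> \<theta> * (poly (P i) x - \<Phi> $ i)"
    using m[OF assms(2)] \<open>\<theta> \<ge> 0\<close> by (intro mult_left_mono) auto
  ultimately show ?thesis
    by (simp add: limiter_step1_def algebra_simps flip: \<theta>_def)
qed

text \<open>The total is treated as one scalar function, whose largest excess
  \<open>M - \<phi>\<close> is scaled to at most \<open>\<phi>max - \<phi>\<close>.\<close>

lemma limiter_step2_in_phi_domain:
  assumes "compact I" "x \<in> I" "x0 \<in> I"
    and "(\<Sum>i\<in>UNIV. poly (P i) x0) = (\<Sum>i\<in>UNIV. \<Phi> $ i)"
    and "\<Phi> \<in> phi_domain \<phi>max" "\<And>i. poly (P i) x \<ge> 0"
  shows "(\<chi> i. poly (limiter_step2 \<phi>max I \<Phi> P i) x) \<in> phi_domain \<phi>max"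
proof -
  define M where "M = (GREATEST y. y \<in> (\<lambda>x. \<Sum>i\<in>UNIV. poly (P i) x) ` I)"
  define \<phi> where "\<phi> = (\<Sum>i\<in>UNIV. \<Phi> $ i)"
  define \<theta> where "\<theta> = limiter_theta_hat \<phi>max I \<Phi> P"
  have M: "(\<Sum>i\<in>UNIV. poly (P i) y) \<le> M" if "y \<in> I" for y
    unfolding M_def
    by (rule Greatest_image_ge[OF assms(1) _ that]) (intro continuous_intros)
  have "\<phi> \<le> M" using M[OF assms(3)] assms(4) by (simp add: \<phi>_def)
  have "\<phi> \<le> \<phi>max" using assms(5) by (simp add: phi_domain_def \<phi>_def)
  have \<theta>: "\<theta> = (if M - \<phi> = 0 then 1 else min \<bar>(\<phi>max - \<phi>) / (M - \<phi>)\<bar> 1)"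
    by (simp add: \<theta>_def M_def \<phi>_def limiter_theta_hat_def Let_def)
  have "0 \<le> \<theta>" "\<theta> \<le> 1" using \<theta> by auto
  have poly: "poly (limiter_step2 \<phi>max I \<Phi> P i) x = \<theta> * poly (P i) x + (1 - \<theta>) * \<Phi> $ i" for i
    by (simp add: limiter_step2_def algebra_simps flip: \<theta>_def)
  have "\<theta> * (M - \<phi>) \<le> \<phi>max - \<phi>"
  proof (cases "M = \<phi>")
    case False
    hence "M - \<phi> > 0" using \<open>\<phi> \<le> M\<close> by simp
    \<comment> \<open>Numerator and denominator are nonnegative, so the absolute value equals the
      quotient.\<close>
    moreover from this have "\<theta> \<le> (\<phi>max - \<phi>) / (M - \<phi>)" using \<theta> \<open>\<phi> \<le> \<phi>max\<close> by simp
    ultimately show ?thesis by (simp add: pos_le_divide_eq)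
  qed (use \<open>\<phi> \<le> \<phi>max\<close> in simp)
  moreover have "\<theta> * (\<Sum>i\<in>UNIV. poly (P i) x) \<le> \<theta> * M"
    using M[OF assms(2)] \<open>0 \<le> \<theta>\<close> by (rule mult_left_mono)
  moreover have "(\<Sum>i\<in>UNIV. poly (limiter_step2 \<phi>max I \<Phi> P i) x) =
      \<theta> * (\<Sum>i\<in>UNIV. poly (P i) x) + (1 - \<theta>) * \<phi>"
    by (simp add: poly sum.distrib sum_distrib_left \<phi>_def)
  ultimately have "(\<Sum>i\<in>UNIV. poly (limiter_step2 \<phi>max I \<Phi> P i) x) \<le> \<phi>max"
    by (simp add: algebra_simps)
  moreover have "poly (limiter_step2 \<phi>max I \<Phi> P i) x \<ge> 0" for i
    using assms(5,6) \<open>0 \<le> \<theta>\<close> \<open>\<theta> \<le> 1\<close> by (simp add: poly phi_domain_def)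
  ultimately show ?thesis by (simp add: phi_domain_def)
qed

lemma limited_poly_in_phi_domain:
  assumes "h > 0" "\<delta> \<ge> 0" "\<Phi> \<in> phi_domain_delta \<delta> \<phi>max"
    and avg: "\<And>i. cell_average a h j (P i) = \<Phi> $ i" and "x \<in> cell a h j"
  shows "(\<chi> i. poly (limited_poly \<delta> \<phi>max (cell a h j) \<Phi> P i) x) \<in> phi_domain \<phi>max"
proof -
  let ?I = "cell a h j"
  let ?Q = "limiter_step1 \<delta> ?I \<Phi> P"
  have \<Phi>: "\<Phi> $ i \<ge> \<delta>" for i using assms(3) by (simp add: phi_domain_delta_def)
  have "compact ?I" by (simp add: cell_def)
  have nonneg: "poly (?Q i) x \<ge> 0" for i
  proof -
    obtain x0 where "x0 \<in> ?I" "poly (P i) x0 = \<Phi> $ i"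
      using cell_average_attained[OF assms(1), of a j "P i"] avg by auto
    from poly_limiter_step1_ge[where P = P, OF \<open>compact ?I\<close> assms(5) this \<Phi>] assms(2)
    show ?thesis by linarith
  qed
  \<comment> \<open>Scaling about the average preserves it. Applying the mean value argument to the
    summed polynomial yields a single point for the total, unlike the points above, which depend on
    \<open>i\<close>.\<close>
  have "cell_average a h j (\<Sum>i\<in>UNIV. ?Q i) = (\<Sum>i\<in>UNIV. \<Phi> $ i)"
    by (simp add: cell_average_sum limiter_step1_def cell_average_add cell_average_smult
        cell_average_diff cell_average_const assms(1) avg)
  then obtain x0 where x0: "x0 \<in> ?I" "(\<Sum>i\<in>UNIV. poly (?Q i) x0) = (\<Sum>i\<in>UNIV. \<Phi> $ i)"
    using cell_average_attained[OF assms(1), of a j "\<Sum>i\<in>UNIV. ?Q i"] by (auto simp: poly_sum)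
  have "\<Phi> \<in> phi_domain \<phi>max"
    using assms(2,3) \<Phi> by (auto simp: phi_domain_def phi_domain_delta_def intro: order_trans)
  from limiter_step2_in_phi_domain[OF \<open>compact ?I\<close> assms(5) x0 this nonneg]
  show ?thesis by (simp add: limited_poly_def)
qed

section \<open>Location of the Lobatto nodes\<close>

text \<open>By the chain rule each differentiation contributes the constant inner derivative
  \<open>c\<close>.\<close>

lemma higher_pderiv_pcompose_linear:
  "(pderiv ^^ k) (pcompose q [:b, c:]) = smult (c ^ k) (pcompose ((pderiv ^^ k) q) [:b, c:])"
  for q :: "'a :: idom poly"
  by (induction k) (simp_all add: pderiv_smult pderiv_pcompose pderiv_pCons mult_ac)

lemma coeff_mult_nonneg:
  fixes p q :: "'a :: linordered_idom poly"
  assumes "\<And>i. coeff p i \<ge> 0" "\<And>i. coeff q i \<ge> 0"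
  shows "coeff (p * q) i \<ge> 0"
  unfolding coeff_mult by (intro sum_nonneg mult_nonneg_nonneg assms)

lemma coeff_power_nonneg:
  fixes p :: "'a :: linordered_idom poly"
  assumes "\<And>i. coeff p i \<ge> 0"
  shows "coeff (p ^ n) i \<ge> 0"
  by (induction n arbitrary: i) (auto intro!: coeff_mult_nonneg assms simp: coeff_1)

lemma coeff_higher_pderiv_nonneg:
  fixes p :: "'a :: linordered_idom poly"
  assumes "\<And>i. coeff p i \<ge> 0"
  shows "coeff ((pderiv ^^ k) p) i \<ge> 0"
  by (induction k arbitrary: i) (auto simp: coeff_pderiv assms simp del: of_nat_Suc)

text \<open>The leading term is positive at \<open>t > 0\<close>, and no other term is
  negative.\<close>

lemma poly_pos_of_coeff_nonneg:
  fixes p :: "'a :: linordered_idom poly"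
  assumes "\<And>i. coeff p i \<ge> 0" "p \<noteq> 0" "t > 0"
  shows "poly p t > 0"
  unfolding poly_altdef
proof (rule sum_pos2[of _ "degree p"])
  have "lead_coeff p > 0" using assms by (simp add: order_less_le)
  thus "0 < lead_coeff p * t ^ degree p" using assms(3) by simp
qed (use assms in auto)

text \<open>In characteristic zero each differentiation lowers a positive degree by exactly
  one.\<close>

lemma higher_pderiv_neq_0:
  fixes p :: "'a :: {comm_semiring_1, semiring_no_zero_divisors, semiring_char_0} poly"
  assumes "p \<noteq> 0" "k \<le> degree p"
  shows "(pderiv ^^ k) p \<noteq> 0"
  using assms
proof (induction k arbitrary: p)
  case (Suc k)
  thus ?case
    using Suc.IH[of "pderiv p"] by (simp add: funpow_swap1 degree_pderiv pderiv_eq_0_iff)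
qed simp

lemma legendre_generator_higher_pderiv_neq_0:
  fixes \<xi> :: real
  assumes "k \<le> 2 * n" "\<bar>\<xi>\<bar> > 1"
  shows "poly ((pderiv ^^ k) ([:-1, 0, 1:] ^ n)) \<xi> \<noteq> 0"
proof -
  \<comment> \<open>The sign merges both substitutions into \<open>x = b + b * t\<close>; since
    \<open>b * b = 1\<close>, \<open>x^2 - 1\<close> becomes \<open>t * (t + 2)\<close>, evaluated
    at \<open>t = \<bar>\<xi>\<bar> - 1 > 0\<close>.\<close>
  define b where "b = sgn \<xi>"
  have b: "b * b = 1" "\<xi> = b + b * (\<bar>\<xi>\<bar> - 1)"
    using assms(2) by (auto simp: b_def sgn_if abs_if)
  define q where "q = ([:0, 2, 1:] :: real poly) ^ n"
  have "pcompose [:-1, 0, 1:] [:b, b:] = [:0, 2, 1:]"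
    using b(1) by (simp add: pcompose_pCons algebra_simps)
  hence "pcompose ([:-1, 0, 1:] ^ n) [:b, b:] = q"
    unfolding q_def
    by (induction n) (simp_all only: power_0 power_Suc pcompose_mult pcompose_1)
  hence "poly ((pderiv ^^ k) q) (\<bar>\<xi>\<bar> - 1) = b ^ k * poly ((pderiv ^^ k) ([:-1, 0, 1:] ^ n)) \<xi>"
    using higher_pderiv_pcompose_linear[of k "[:-1, 0, 1:] ^ n" b b] b(2)
    by (simp add: poly_pcompose mult.commute)
  moreover have "poly ((pderiv ^^ k) q) (\<bar>\<xi>\<bar> - 1) > 0"
  proof (rule poly_pos_of_coeff_nonneg)
    have "q \<noteq> 0" "degree q = 2 * n" by (simp_all add: q_def degree_power_eq)
    thus "(pderiv ^^ k) q \<noteq> 0" using assms(1) by (intro higher_pderiv_neq_0) auto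
    have "coeff [:0, 2, 1 :: real:] i \<ge> 0" for i by (simp add: coeff_pCons split: nat.splits)
    thus "coeff ((pderiv ^^ k) q) i \<ge> 0" for i
      unfolding q_def by (intro coeff_higher_pderiv_nonneg coeff_power_nonneg)
  qed (use assms(2) in simp)
  ultimately show ?thesis by auto
qed

lemma lgl_reference_nodes_subset:
  assumes "G \<ge> 2"
  shows "lgl_reference_nodes G \<subseteq> {-1..1}"
proof
  fix \<xi> assume \<xi>: "\<xi> \<in> lgl_reference_nodes G"
  show "\<xi> \<in> {-1..1}"
  proof (rule ccontr)
    assume "\<xi> \<notin> {-1..1}"
    hence abs: "\<bar>\<xi>\<bar> > 1" by auto
    define n where "n = G - 1"
    have "poly [:1, 0, -1:] \<xi> \<noteq> 0"
      using abs power2_eq_1_iff[of \<xi>] by (auto simp: power2_eq_square)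
    \<comment> \<open>Up to a nonzero factor this is the derivative of order \<open>n + 1\<close> of
      \<open>(x^2 - 1)^n\<close>; \<open>G \<ge> 2\<close> gives \<open>n \<ge> 1\<close>, hence
      \<open>n + 1 \<le> 2 * n\<close>.\<close>
    moreover have "poly (pderiv (legendre_poly n)) \<xi> \<noteq> 0"
      using legendre_generator_higher_pderiv_neq_0[of "Suc n" n, OF _ abs] assms
      by (simp add: legendre_poly_def pderiv_smult) (simp add: n_def)
    ultimately show False using \<xi> by (simp add: lgl_reference_nodes_def n_def)
  qed
qed

lemma lgl_nodes_subset_cell:
  assumes "G \<ge> 2" "h > 0"
  shows "lgl_nodes a h G j \<subseteq> cell a h j"
proof
  fix x assume "x \<in> lgl_nodes a h G j"
  then obtain \<xi> where \<xi>: "-1 \<le> \<xi>" "\<xi> \<le> 1" "x = a + of_int j * h + h / 2 * \<xi>"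
    using lgl_reference_nodes_subset[OF assms(1)] unfolding lgl_nodes_def by force
  have "h / 2 * -1 \<le> h / 2 * \<xi>" "h / 2 * \<xi> \<le> h / 2 * 1"
    using \<xi> assms(2) by (intro mult_left_mono; simp)+
  thus "x \<in> cell a h j" using \<xi>(3) by (simp add: cell_def algebra_simps)
qed

theorem lemma1:
  fixes \<phi>max \<delta> a h \<epsilon> p :: real
    and C :: "nat \<Rightarrow> real"
    and r G n :: nat
    and j :: int
    and \<Phi> :: "nat \<Rightarrow> int \<Rightarrow> real ^ 'N"
  assumes "\<phi>max > 0" and "\<delta> > 0" and "h > 0"
    and "r \<in> {1, 2}"
    and "\<forall>k\<in>{0..r+1}. C k \<in> {0..1}" and "(\<Sum>k=0..r+1. C k) = 1" and "C 0 > 0"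
    and "\<epsilon> > 0" and "p \<ge> 2"
    and "G \<ge> 2"
    and "\<Phi> n j \<in> phi_domain_delta \<delta> \<phi>max"
  shows "(\<forall>x\<in>cell a h j.
            limited_reconstruction a h r C \<epsilon> p \<delta> \<phi>max (\<Phi> n) j x \<in> phi_domain \<phi>max) \<and>
         (\<forall>x\<in>lgl_nodes a h G j.
            limited_reconstruction a h r C \<epsilon> p \<delta> \<phi>max (\<Phi> n) j x \<in> phi_domain \<phi>max)"
proof -
  have C: "\<forall>k\<in>{0..r+1}. C k \<ge> 0" using assms(5) by auto
  have avg: "cell_average a h j (weno_poly a h r C \<epsilon> p (\<lambda>l. \<Phi> n l $ i) j) = \<Phi> n j $ i" for i
    by (rule cell_average_weno_poly[OF assms(3) C assms(6-8)])
  have "limited_reconstruction a h r C \<epsilon> p \<delta> \<phi>max (\<Phi> n) j x \<in> phi_domain \<phi>max"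
    if "x \<in> cell a h j" for x
    unfolding limited_reconstruction_def
    using assms(2,3,11) avg that by (intro limited_poly_in_phi_domain) auto
  thus ?thesis using lgl_nodes_subset_cell[OF assms(10,3)] by blast
qed

end
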